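(* Let $\mathbf{T}$ be a Borel tree-semilattice equipped with an atomless Borel probability measure $\mu$. Then there exists a sequence of finite tree-semilattices $\mathbf{T}_n$, each equipped with the uniform probability measure on its domain, which QF-converges to $(\mathbf{T},\mu)$, i.e. $\lim_{n\to\infty}\langle\phi,\mathbf T_n\rangle=\langle\phi,(\mathbf T,\mu)\rangle$ for every quantifier-free formula $\phi$.
   Context: A tree-semilattice is a structure $\mathbf{T}=(T,\wedge)$ where $\wedge$ is idempotent, commutative and associative, and for all $x,y,z$, if $x\wedge z=x$ and $y\wedge z=y$ then $x\wedge y\in\{x,y\}$. A Borel tree-semilattice has a standard Borel space $T$ as domain and Borel map $\wedge:T\times T\to T$. For a quantifier-free formula $\phi$ (in the language of $\wedge$ and equality) with $p$ free variables and a probability measure $\mu$ on $T$, $\langle\phi,(\mathbf T,\mu)\rangle=\mu^{\otimes p}(\{(v_1,\dots,v_p)\in T^p:\mathbf T\models\phi(v_1,\dots,v_p)\})$; for a finite structure with uniform measure this is the probability that a uniformly random assignment satisfies $\phi$. Atomless means every singleton has measure $0$. *)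

theory Defs
  imports "HOL-Analysis.Analysis" "HOL-Probability.Probability"
begin

locale tree_semilattice =
  fixes T :: "'a set" and meet :: "'a \<Rightarrow> 'a \<Rightarrow> 'a" (infixl "\<sqinter>\<^sub>T" 70)
  assumes meet_closed: "\<lbrakk>x \<in> T; y \<in> T\<rbrakk> \<Longrightarrow> x \<sqinter>\<^sub>T y \<in> T"
    and meet_idem: "x \<in> T \<Longrightarrow> x \<sqinter>\<^sub>T x = x"
    and meet_commute: "\<lbrakk>x \<in> T; y \<in> T\<rbrakk> \<Longrightarrow> x \<sqinter>\<^sub>T y = y \<sqinter>\<^sub>T x"
    and meet_assoc: "\<lbrakk>x \<in> T; y \<in> T; z \<in> T\<rbrakk> \<Longrightarrow> (x \<sqinter>\<^sub>T y) \<sqinter>\<^sub>T z = x \<sqinter>\<^sub>T (y \<sqinter>\<^sub>T z)"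
    and meet_tree: "\<lbrakk>x \<in> T; y \<in> T; z \<in> T; x \<sqinter>\<^sub>T z = x; y \<sqinter>\<^sub>T z = y\<rbrakk> \<Longrightarrow> x \<sqinter>\<^sub>T y \<in> {x, y}"

text \<open>
  A measurable space is standard Borel if its sigma-algebra is generated by the open sets of
  some Polish topology. Only the sigma-algebra of \<open>M\<close> matters, not its measure.
\<close>
definition standard_borel :: "'a measure \<Rightarrow> bool" where
  "standard_borel M \<longleftrightarrow>
     (\<exists>X. topspace X = space M \<and> completely_metrizable_space X \<and> separable_space X \<and>
          sets M = sigma_sets (topspace X) {U. openin X U})"

definition borel_tree_semilattice :: "'a measure \<Rightarrow> ('a \<Rightarrow> 'a \<Rightarrow> 'a) \<Rightarrow> bool" where
  "borel_tree_semilattice M meet \<longleftrightarrow>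
     standard_borel M \<and> tree_semilattice (space M) meet \<and>
     (\<lambda>(x, y). meet x y) \<in> M \<Otimes>\<^sub>M M \<rightarrow>\<^sub>M M"

definition atomless :: "'a measure \<Rightarrow> bool" where
  "atomless M \<longleftrightarrow> (\<forall>x\<in>space M. emeasure M {x} = 0)"

text \<open>Quantifier-free first-order formulas in the language of one binary operation and equality.\<close>

datatype tm = Var nat | Meet tm tm

datatype qf = Eq tm tm | Neg qf | Conj qf qf | Disj qf qf

fun tm_vars :: "tm \<Rightarrow> nat set" where
  "tm_vars (Var i) = {i}"
| "tm_vars (Meet s t) = tm_vars s \<union> tm_vars t"

fun free_vars :: "qf \<Rightarrow> nat set" where
  "free_vars (Eq s t) = tm_vars s \<union> tm_vars t"
| "free_vars (Neg \<phi>) = free_vars \<phi>"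
| "free_vars (Conj \<phi> \<psi>) = free_vars \<phi> \<union> free_vars \<psi>"
| "free_vars (Disj \<phi> \<psi>) = free_vars \<phi> \<union> free_vars \<psi>"

fun tm_val :: "('a \<Rightarrow> 'a \<Rightarrow> 'a) \<Rightarrow> (nat \<Rightarrow> 'a) \<Rightarrow> tm \<Rightarrow> 'a" where
  "tm_val meet v (Var i) = v i"
| "tm_val meet v (Meet s t) = meet (tm_val meet v s) (tm_val meet v t)"

fun qf_sat :: "('a \<Rightarrow> 'a \<Rightarrow> 'a) \<Rightarrow> (nat \<Rightarrow> 'a) \<Rightarrow> qf \<Rightarrow> bool" where
  "qf_sat meet v (Eq s t) \<longleftrightarrow> tm_val meet v s = tm_val meet v t"
| "qf_sat meet v (Neg \<phi>) \<longleftrightarrow> \<not> qf_sat meet v \<phi>"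
| "qf_sat meet v (Conj \<phi> \<psi>) \<longleftrightarrow> qf_sat meet v \<phi> \<and> qf_sat meet v \<psi>"
| "qf_sat meet v (Disj \<phi> \<psi>) \<longleftrightarrow> qf_sat meet v \<phi> \<or> qf_sat meet v \<psi>"

text \<open>
  The power \<open>\<mu>\<^sup>p\<close> is indexed by the set of the \<open>p\<close> free variables of the formula, so that the
  points of the product space are exactly the assignments of its free variables.
\<close>
definition stone_pairing :: "qf \<Rightarrow> 'a measure \<Rightarrow> ('a \<Rightarrow> 'a \<Rightarrow> 'a) \<Rightarrow> real" where
  "stone_pairing \<phi> M meet =
     (let P = PiM (free_vars \<phi>) (\<lambda>_. M) in measure P {v \<in> space P. qf_sat meet v \<phi>})"

definition qf_converges ::
  "(nat \<Rightarrow> 'b measure) \<Rightarrow> (nat \<Rightarrow> 'b \<Rightarrow> 'b \<Rightarrow> 'b) \<Rightarrow> 'a measure \<Rightarrow> ('a \<Rightarrow> 'a \<Rightarrow> 'a) \<Rightarrow> bool" where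
  "qf_converges N m M meet \<longleftrightarrow>
     (\<forall>\<phi>. (\<lambda>n. stone_pairing \<phi> (N n) (m n)) \<longlonglongrightarrow> stone_pairing \<phi> M meet)"

end

theory Submission
  imports Defs
begin

text \<open>
  Sample \<open>N\<close> independent points of \<open>T\<close>. The frequency with which an injective choice of sample
  points satisfies \<open>\<phi>\<close> has mean close to \<open>\<langle>\<phi>, (T, \<mu>)\<rangle>\<close>, and its variance tends to \<open>0\<close> because two
  random choices of indices are almost always disjoint, hence independent. The sample is turned into
  a finite tree-semilattice by adding the pairwise meets of sample points; to make these meets
  negligible for the uniform measure, each sample point is replaced by a long chain of copies. As
  \<open>\<mu>\<close> is atomless, almost surely no meet of two sample points is a third sample point, and then
  copies of distinct sample points satisfy the same quantifier-free formulas as the points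
  themselves. There are countably many formulas, so a diagonal choice of samples converges.
\<close>

section \<open>Tree-semilattices and lexicographic products\<close>

text \<open>Every point is replaced by a chain of copies, with the copy labelled \<open>0\<close> on top.\<close>

definition lex_meet :: "('a \<Rightarrow> 'a \<Rightarrow> 'a) \<Rightarrow> 'a \<times> nat \<Rightarrow> 'a \<times> nat \<Rightarrow> 'a \<times> nat" where
  "lex_meet m p q =
     (if fst p = fst q then (fst p, max (snd p) (snd q))
      else if m (fst p) (fst q) = fst p then p
      else if m (fst p) (fst q) = fst q then q
      else (m (fst p) (fst q), 0))"

text \<open>For \<open>V\<close> inside a tree-semilattice this is the subsemilattice generated by
  \<open>V\<close>: idempotence puts \<open>V\<close> into it, and the tree axiom makes it
  closed.\<close>

definition pair_meets :: "('a \<Rightarrow> 'a \<Rightarrow> 'a) \<Rightarrow> 'a set \<Rightarrow> 'a set" where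
  "pair_meets m V = (\<lambda>(x, y). m x y) ` (V \<times> V)"

lemma pair_meetsI: "x \<in> V \<Longrightarrow> y \<in> V \<Longrightarrow> m x y \<in> pair_meets m V"
  by (auto simp: pair_meets_def)

context tree_semilattice
begin

lemma le_trans: "x \<in> T \<Longrightarrow> y \<in> T \<Longrightarrow> z \<in> T \<Longrightarrow> x \<sqinter>\<^sub>T y = x \<Longrightarrow> y \<sqinter>\<^sub>T z = y \<Longrightarrow> x \<sqinter>\<^sub>T z = x"
  using meet_assoc[of x y z] by simp

lemma meet_le1: "x \<in> T \<Longrightarrow> y \<in> T \<Longrightarrow> (x \<sqinter>\<^sub>T y) \<sqinter>\<^sub>T x = x \<sqinter>\<^sub>T y"
  using meet_assoc[of x x y] meet_commute[of "x \<sqinter>\<^sub>T y" x] meet_closed[of x y] meet_idem[of x] by simp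

lemma meet_le2: "x \<in> T \<Longrightarrow> y \<in> T \<Longrightarrow> (x \<sqinter>\<^sub>T y) \<sqinter>\<^sub>T y = x \<sqinter>\<^sub>T y"
  using meet_assoc[of x y y] meet_idem[of y] by simp

lemma meet_greatest:
  "x \<in> T \<Longrightarrow> y \<in> T \<Longrightarrow> z \<in> T \<Longrightarrow> z \<sqinter>\<^sub>T x = z \<Longrightarrow> z \<sqinter>\<^sub>T y = z \<Longrightarrow> z \<sqinter>\<^sub>T (x \<sqinter>\<^sub>T y) = z"
  using meet_assoc[of z x y] by simp

text \<open>Associativity comes from the order instead of a case analysis: \<open>lex_meet\<close>
  is the greatest lower bound for the lexicographic order \<open>le\<close>. The tree axiom is
  inherited from the first components, since copies of one point form a chain.\<close>

lemma lex_meet_tree_semilattice: "tree_semilattice (T \<times> UNIV) (lex_meet meet)"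
proof -
  \<comment> \<open>Labels are ordered downwards, so that label 0 is the top of each chain and
    \<open>max\<close> is the meet of two labels.\<close>
  define le :: "'a \<times> nat \<Rightarrow> 'a \<times> nat \<Rightarrow> bool"
    where "le p q = (if fst p = fst q then snd q \<le> snd p else meet (fst p) (fst q) = fst p)" for p q
  have le_trans: "le p r" if "le p q" "le q r" "p \<in> T \<times> UNIV" "q \<in> T \<times> UNIV" "r \<in> T \<times> UNIV" for p q r
  proof -
    have T: "fst p \<in> T" "fst q \<in> T" "fst r \<in> T"
      using that by (auto simp: mem_Times_iff)
    show ?thesis
    proof (cases "fst p = fst q \<or> fst q = fst r")
      case True
      then show ?thesis using that by (auto simp: le_def split: if_splits)
    next
      case False
      then have *: "fst p \<sqinter>\<^sub>T fst q = fst p" "fst q \<sqinter>\<^sub>T fst r = fst q"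
        using that by (auto simp: le_def)
      \<comment> \<open>If \<open>fst p = fst r\<close>, commutativity would turn the two equations
        into \<open>fst p = fst q\<close>.\<close>
      with False have "fst p \<noteq> fst r"
        using meet_commute[OF T(1,2)] by metis
      with * show ?thesis
        using T le_trans[of "fst p" "fst q" "fst r"] by (simp add: le_def)
    qed
  qed
  have le_antisym: "p = q" if "le p q" "le q p" "p \<in> T \<times> UNIV" "q \<in> T \<times> UNIV" for p q
  proof (cases "fst p = fst q")
    case True
    then show ?thesis using that by (simp add: le_def prod_eq_iff)
  next
    case False
    then show ?thesis
      using that meet_commute[of "fst p" "fst q"] by (simp add: le_def mem_Times_iff)
  qed
  have closed: "lex_meet meet p q \<in> T \<times> UNIV" if "p \<in> T \<times> UNIV" "q \<in> T \<times> UNIV" for p q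
    using that by (simp add: lex_meet_def mem_Times_iff meet_closed)
  have lower1: "le (lex_meet meet p q) p" if "p \<in> T \<times> UNIV" "q \<in> T \<times> UNIV" for p q
  proof -
    have T: "fst p \<in> T" "fst q \<in> T"
      using that by (simp_all add: mem_Times_iff)
    show ?thesis
      using meet_le1[OF T] by (simp add: lex_meet_def le_def meet_commute[OF T(2,1)])
  qed
  have comm: "lex_meet meet p q = lex_meet meet q p" if "p \<in> T \<times> UNIV" "q \<in> T \<times> UNIV" for p q
  proof -
    have T: "fst p \<in> T" "fst q \<in> T"
      using that by (simp_all add: mem_Times_iff)
    show ?thesis
      by (simp add: lex_meet_def meet_commute[OF T(2,1)] max.commute)
  qed
  have lower2: "le (lex_meet meet p q) q" if "p \<in> T \<times> UNIV" "q \<in> T \<times> UNIV" for p q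
    using lower1[OF that(2,1)] comm[OF that] by simp
  have greatest: "le r (lex_meet meet p q)"
    if "le r p" "le r q" "p \<in> T \<times> UNIV" "q \<in> T \<times> UNIV" "r \<in> T \<times> UNIV" for p q r
  proof -
    have T: "fst p \<in> T" "fst q \<in> T" "fst r \<in> T"
      using that by (auto simp: mem_Times_iff)
    have "fst r \<sqinter>\<^sub>T fst p = fst r" "fst r \<sqinter>\<^sub>T fst q = fst r"
      using that(1,2) meet_idem[OF T(3)] by (simp_all add: le_def split: if_splits)
    then have "fst r \<sqinter>\<^sub>T (fst p \<sqinter>\<^sub>T fst q) = fst r"
      using T by (intro meet_greatest)
    \<comment> \<open>A meet distinct from both first components gets label 0, the top of its chain,
      so every copy of that meet lies below it.\<close>
    with that(1,2) show ?thesis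
      by (simp add: le_def lex_meet_def)
  qed
  show ?thesis
  proof
    fix x y z assume xyz: "x \<in> T \<times> (UNIV :: nat set)" "y \<in> T \<times> (UNIV :: nat set)" "z \<in> T \<times> (UNIV :: nat set)"
    let ?l = "lex_meet meet (lex_meet meet x y) z" and ?r = "lex_meet meet x (lex_meet meet y z)"
    have mem: "lex_meet meet x y \<in> T \<times> UNIV" "lex_meet meet y z \<in> T \<times> UNIV" "?l \<in> T \<times> UNIV" "?r \<in> T \<times> UNIV"
      using xyz by (simp_all add: closed)
    have l: "le ?l x" "le ?l y" "le ?l z"
      by (rule le_trans[OF lower1[OF mem(1) xyz(3)] lower1[OF xyz(1,2)] mem(3,1) xyz(1)],
          rule le_trans[OF lower1[OF mem(1) xyz(3)] lower2[OF xyz(1,2)] mem(3,1) xyz(2)],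
          rule lower2[OF mem(1) xyz(3)])
    have r: "le ?r x" "le ?r y" "le ?r z"
      by (rule lower1[OF xyz(1) mem(2)],
          rule le_trans[OF lower2[OF xyz(1) mem(2)] lower1[OF xyz(2,3)] mem(4,2) xyz(2)],
          rule le_trans[OF lower2[OF xyz(1) mem(2)] lower2[OF xyz(2,3)] mem(4,2) xyz(3)])
    \<comment> \<open>Both bracketings are greatest lower bounds of \<open>x\<close>,
      \<open>y\<close>, \<open>z\<close>, hence each is below the other.\<close>
    have "le ?l ?r"
      by (rule greatest[OF l(1) greatest[OF l(2,3) xyz(2,3) mem(3)] xyz(1) mem(2,3)])
    moreover have "le ?r ?l"
      by (rule greatest[OF greatest[OF r(1,2) xyz(1,2) mem(4)] r(3) mem(1) xyz(3) mem(4)])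
    ultimately show "?l = ?r"
      by (rule le_antisym[OF _ _ mem(3,4)])
  next
    fix x y z assume xyz: "x \<in> T \<times> (UNIV :: nat set)" "y \<in> T \<times> (UNIV :: nat set)" "z \<in> T \<times> (UNIV :: nat set)"
      and "lex_meet meet x z = x" "lex_meet meet y z = y"
    then have "le x z" "le y z"
      using lower2[OF xyz(1,3)] lower2[OF xyz(2,3)] by simp_all
    then have "fst x \<sqinter>\<^sub>T fst z = fst x" "fst y \<sqinter>\<^sub>T fst z = fst y"
      using xyz meet_idem[of "fst z"] by (simp_all add: le_def mem_Times_iff split: if_splits)
    then have "fst x \<sqinter>\<^sub>T fst y \<in> {fst x, fst y}"
      using xyz by (intro meet_tree[where z = "fst z"]) (simp_all add: mem_Times_iff)
    then show "lex_meet meet x y \<in> {x, y}"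
      by (auto simp: lex_meet_def prod_eq_iff max_def)
  next
    fix x assume "x \<in> T \<times> (UNIV :: nat set)"
    then show "lex_meet meet x x = x"
      by (simp add: lex_meet_def)
  qed (fact closed comm)+
qed

lemma tree_semilattice_subset:
  assumes "S \<subseteq> T" "\<And>x y. x \<in> S \<Longrightarrow> y \<in> S \<Longrightarrow> x \<sqinter>\<^sub>T y \<in> S"
  shows "tree_semilattice S meet"
proof
  fix x y z assume "x \<in> S" "y \<in> S" "z \<in> S" "x \<sqinter>\<^sub>T z = x" "y \<sqinter>\<^sub>T z = y"
  with assms(1) show "x \<sqinter>\<^sub>T y \<in> {x, y}"
    by (intro meet_tree[of x y z]) auto
next
  fix x y assume "x \<in> S" "y \<in> S"
  with assms(1) show "x \<sqinter>\<^sub>T y = y \<sqinter>\<^sub>T x"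
    by (intro meet_commute) auto
qed (use assms(1) in \<open>simp_all add: assms(2) subset_iff meet_idem meet_assoc\<close>)

text \<open>An isomorphic copy along an injection; it later moves the finite carriers into
  \<open>nat\<close>.\<close>

lemma tree_semilattice_transport:
  assumes "inj_on f T"
  shows "tree_semilattice (f ` T) (\<lambda>x y. f (inv_into T f x \<sqinter>\<^sub>T inv_into T f y))"
proof
  fix x y z assume "x \<in> f ` T" "y \<in> f ` T" "z \<in> f ` T"
    and eq: "f (inv_into T f x \<sqinter>\<^sub>T inv_into T f z) = x" "f (inv_into T f y \<sqinter>\<^sub>T inv_into T f z) = y"
  then obtain a b c where abc: "x = f a" "y = f b" "z = f c" "a \<in> T" "b \<in> T" "c \<in> T"
    by blast
  with eq have "a \<sqinter>\<^sub>T c = a" "b \<sqinter>\<^sub>T c = b"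
    using assms by (simp_all add: inj_on_eq_iff meet_closed)
  with abc meet_tree[of a b c] show "f (inv_into T f x \<sqinter>\<^sub>T inv_into T f y) \<in> {x, y}"
    using assms by auto
next
  fix x y assume "x \<in> f ` T" "y \<in> f ` T"
  then show "f (inv_into T f x \<sqinter>\<^sub>T inv_into T f y) = f (inv_into T f y \<sqinter>\<^sub>T inv_into T f x)"
    by (intro arg_cong[where f = f] meet_commute inv_into_into)
qed (use assms in \<open>auto simp: meet_closed meet_idem meet_assoc\<close>)

lemma pair_meets_subset: "V \<subseteq> T \<Longrightarrow> pair_meets meet V \<subseteq> T"
  using meet_closed by (auto simp: pair_meets_def)

text \<open>The meet of finitely many points of a tree is already the meet of two of them.\<close>
lemma pair_meets_closed:
  assumes V: "V \<subseteq> T" and "x \<in> pair_meets meet V" "y \<in> pair_meets meet V"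
  shows "x \<sqinter>\<^sub>T y \<in> pair_meets meet V"
proof -
  \<comment> \<open>Both pairwise meets lie below \<open>a\<close>, so the tree axiom makes them
    comparable; the smaller one is the triple meet.\<close>
  have three: "(a \<sqinter>\<^sub>T b) \<sqinter>\<^sub>T c \<in> {a \<sqinter>\<^sub>T b, a \<sqinter>\<^sub>T c}" if "a \<in> T" "b \<in> T" "c \<in> T" for a b c
  proof -
    have "(a \<sqinter>\<^sub>T b) \<sqinter>\<^sub>T (a \<sqinter>\<^sub>T c) = ((a \<sqinter>\<^sub>T b) \<sqinter>\<^sub>T a) \<sqinter>\<^sub>T c"
      using that by (simp add: meet_assoc meet_closed)
    also have "\<dots> = (a \<sqinter>\<^sub>T b) \<sqinter>\<^sub>T c"
      using that by (simp add: meet_le1)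
    finally have "(a \<sqinter>\<^sub>T b) \<sqinter>\<^sub>T (a \<sqinter>\<^sub>T c) = (a \<sqinter>\<^sub>T b) \<sqinter>\<^sub>T c" .
    moreover have "(a \<sqinter>\<^sub>T b) \<sqinter>\<^sub>T (a \<sqinter>\<^sub>T c) \<in> {a \<sqinter>\<^sub>T b, a \<sqinter>\<^sub>T c}"
      using that by (intro meet_tree[where z = a]) (simp_all add: meet_le1 meet_closed)
    ultimately show ?thesis by simp
  qed
  obtain a b where x: "x = a \<sqinter>\<^sub>T b" "a \<in> V" "b \<in> V" using assms by (auto simp: pair_meets_def)
  obtain c d where y: "y = c \<sqinter>\<^sub>T d" "c \<in> V" "d \<in> V" using assms by (auto simp: pair_meets_def)
  have *: "(a \<sqinter>\<^sub>T b) \<sqinter>\<^sub>T c \<in> pair_meets meet V" if "a \<in> V" "b \<in> V" "c \<in> V" for a b c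
  proof -
    have "(a \<sqinter>\<^sub>T b) \<sqinter>\<^sub>T c \<in> {a \<sqinter>\<^sub>T b, a \<sqinter>\<^sub>T c}"
      using that V by (intro three) auto
    with that show ?thesis
      using pair_meetsI[of a V b meet] pair_meetsI[of a V c meet] by auto
  qed
  \<comment> \<open>The factors \<open>c\<close> and \<open>d\<close> are absorbed one after the
    other: the triple meet with \<open>c\<close> is a pairwise meet, and what remains is a triple
    meet with \<open>d\<close>.\<close>
  have "x \<sqinter>\<^sub>T y = ((a \<sqinter>\<^sub>T b) \<sqinter>\<^sub>T c) \<sqinter>\<^sub>T d"
    using x y V meet_assoc[of "a \<sqinter>\<^sub>T b" c d] meet_closed[of a b] by (simp add: subset_iff)
  moreover have "(a \<sqinter>\<^sub>T b) \<sqinter>\<^sub>T c \<in> {a \<sqinter>\<^sub>T b, a \<sqinter>\<^sub>T c}"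
    using x y V by (intro three) auto
  ultimately show ?thesis
    using * x y by auto
qed

end

section \<open>Stone pairings of finite structures\<close>

lemma finite_tm_vars [simp]: "finite (tm_vars t)"
  by (induction t) auto

lemma finite_free_vars [simp]: "finite (free_vars \<phi>)"
  by (induction \<phi>) auto

lemma tm_val_cong: "(\<And>i. i \<in> tm_vars t \<Longrightarrow> u i = v i) \<Longrightarrow> tm_val m u t = tm_val m v t"
  by (induction t) auto

lemma qf_sat_cong: "(\<And>i. i \<in> free_vars \<phi> \<Longrightarrow> u i = v i) \<Longrightarrow> qf_sat m u \<phi> = qf_sat m v \<phi>"
proof (induction \<phi>)
  case (Eq s t)
  then show ?case
    using tm_val_cong[of s u v m] tm_val_cong[of t u v m] by simp
qed auto

lemma tm_val_embedding:
  assumes "\<And>x y. x \<in> S \<Longrightarrow> y \<in> S \<Longrightarrow> m x y \<in> S" "\<And>x y. x \<in> S \<Longrightarrow> y \<in> S \<Longrightarrow> h (m x y) = m' (h x) (h y)"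
    and "u ` tm_vars t \<subseteq> S"
  shows "tm_val m u t \<in> S \<and> tm_val m' (\<lambda>i. h (u i)) t = h (tm_val m u t)"
  using assms(3)
proof (induction t)
  case (Meet s t)
  have "u ` tm_vars s \<subseteq> S" "u ` tm_vars t \<subseteq> S"
    using Meet.prems by auto
  with Meet.IH have "tm_val m u s \<in> S \<and> tm_val m' (\<lambda>i. h (u i)) s = h (tm_val m u s)"
    "tm_val m u t \<in> S \<and> tm_val m' (\<lambda>i. h (u i)) t = h (tm_val m u t)"
    by blast+
  then show ?case by (simp add: assms(1,2))
qed simp

text \<open>Term values commute with a homomorphism on a closed set. Injectivity turns this into an
  equivalence for equations, and equivalences pass through all connectives, negation
  included.\<close>

lemma qf_sat_embedding:
  assumes "\<And>x y. x \<in> S \<Longrightarrow> y \<in> S \<Longrightarrow> m x y \<in> S" "\<And>x y. x \<in> S \<Longrightarrow> y \<in> S \<Longrightarrow> h (m x y) = m' (h x) (h y)"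
    and "inj_on h S" "u ` free_vars \<phi> \<subseteq> S"
  shows "qf_sat m' (\<lambda>i. h (u i)) \<phi> = qf_sat m u \<phi>"
  using assms(4)
proof (induction \<phi>)
  case (Eq s t)
  have "tm_val m u s \<in> S \<and> tm_val m' (\<lambda>i. h (u i)) s = h (tm_val m u s)"
    "tm_val m u t \<in> S \<and> tm_val m' (\<lambda>i. h (u i)) t = h (tm_val m u t)"
    using Eq by (intro tm_val_embedding[where S = S and m = m] assms(1,2); auto)+
  then show ?case
    using assms(3) by (simp add: inj_on_eq_iff)
qed (simp_all add: image_Un)

lemma stone_pairing_uniform_count_measure:
  assumes "finite A" "A \<noteq> {}"
  shows "stone_pairing \<phi> (uniform_count_measure A) m =
    card {u \<in> free_vars \<phi> \<rightarrow>\<^sub>E A. qf_sat m u \<phi>} / card A ^ card (free_vars \<phi>)"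
proof -
  let ?U = "uniform_count_measure A" and ?I = "free_vars \<phi>"
  let ?S = "{u \<in> ?I \<rightarrow>\<^sub>E A. qf_sat m u \<phi>}"
  interpret U: prob_space ?U
    using assms by (rule prob_space_uniform_count_measure)
  interpret P: finite_product_prob_space "\<lambda>_. ?U" ?I
    by standard simp
  have space: "space (PiM ?I (\<lambda>_. ?U)) = ?I \<rightarrow>\<^sub>E A"
    by (simp add: space_PiM space_uniform_count_measure)
  \<comment> \<open>A single assignment is a box of singletons, so the product formula gives its
    probability.\<close>
  have sing: "{u} = Pi\<^sub>E ?I (\<lambda>i. {u i})" if "u \<in> ?I \<rightarrow>\<^sub>E A" for u
    using that by (simp add: PiE_singleton PiE_iff)
  have sing_sets: "{u} \<in> sets (PiM ?I (\<lambda>_. ?U))" if "u \<in> ?I \<rightarrow>\<^sub>E A" for u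
    using that by (subst sing) (auto intro!: sets_PiM_I_finite simp: sets_uniform_count_measure)
  have meas: "P.prob {u} = 1 / card A ^ card ?I" if "u \<in> ?I \<rightarrow>\<^sub>E A" for u
  proof -
    have "P.prob {u} = (\<Prod>i\<in>?I. U.prob {u i})"
      using that by (subst sing, simp, subst P.finite_measure_PiM_emb) (auto simp: sets_uniform_count_measure)
    also have "\<dots> = (\<Prod>i\<in>?I. 1 / card A)"
      using that assms by (intro prod.cong refl) (auto simp: measure_uniform_count_measure PiE_iff)
    finally show ?thesis by (simp add: power_one_over)
  qed
  have fin: "finite ?S"
    using assms by (intro finite_subset[OF _ finite_PiE[of ?I "\<lambda>_. A"]]) auto
  have "P.prob ?S = (\<Sum>u\<in>?S. P.prob {u})"
    using fin sing_sets by (intro P.finite_measure_eq_sum_singleton) auto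
  also have "\<dots> = (\<Sum>u\<in>?S. 1 / card A ^ card ?I)"
    by (intro sum.cong refl meas) auto
  finally show ?thesis
    unfolding stone_pairing_def Let_def space by simp
qed

text \<open>Pairings are isomorphism invariants: composing assignments with \<open>f\<close> is a
  bijection that respects satisfaction.\<close>

lemma stone_pairing_transport:
  assumes "finite A" "A \<noteq> {}" "inj_on f A" "\<And>x y. x \<in> A \<Longrightarrow> y \<in> A \<Longrightarrow> m x y \<in> A"
  shows "stone_pairing \<phi> (uniform_count_measure (f ` A)) (\<lambda>x y. f (m (inv_into A f x) (inv_into A f y))) =
    stone_pairing \<phi> (uniform_count_measure A) m"
proof -
  let ?I = "free_vars \<phi>" and ?m = "\<lambda>x y. f (m (inv_into A f x) (inv_into A f y))"
  have sat: "qf_sat ?m (\<lambda>i\<in>?I. f (u i)) \<phi> = qf_sat m u \<phi>" if "u \<in> ?I \<rightarrow>\<^sub>E A" for u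
  proof -
    have "qf_sat ?m (\<lambda>i\<in>?I. f (u i)) \<phi> = qf_sat ?m (\<lambda>i. f (u i)) \<phi>"
      by (rule qf_sat_cong) simp
    also have "\<dots> = qf_sat m u \<phi>"
      using assms that by (intro qf_sat_embedding[where S = A]) auto
    finally show ?thesis .
  qed
  have "bij_betw (\<lambda>u. \<lambda>i\<in>?I. f (u i)) {u \<in> ?I \<rightarrow>\<^sub>E A. qf_sat m u \<phi>} {u \<in> ?I \<rightarrow>\<^sub>E f ` A. qf_sat ?m u \<phi>}"
  proof (rule bij_betwI')
    fix u v assume "u \<in> {u \<in> ?I \<rightarrow>\<^sub>E A. qf_sat m u \<phi>}" "v \<in> {u \<in> ?I \<rightarrow>\<^sub>E A. qf_sat m u \<phi>}"
    then show "((\<lambda>i\<in>?I. f (u i)) = (\<lambda>i\<in>?I. f (v i))) = (u = v)"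
      using assms(3) by (auto simp: fun_eq_iff PiE_iff extensional_def restrict_def inj_on_def) metis
  next
    fix u assume "u \<in> {u \<in> ?I \<rightarrow>\<^sub>E A. qf_sat m u \<phi>}"
    then show "(\<lambda>i\<in>?I. f (u i)) \<in> {u \<in> ?I \<rightarrow>\<^sub>E f ` A. qf_sat ?m u \<phi>}"
      using sat by auto
  next
    fix v assume v: "v \<in> {u \<in> ?I \<rightarrow>\<^sub>E f ` A. qf_sat ?m u \<phi>}"
    define u where "u = (\<lambda>i\<in>?I. inv_into A f (v i))"
    have "u \<in> ?I \<rightarrow>\<^sub>E A" "v = (\<lambda>i\<in>?I. f (u i))"
      using v by (auto simp: u_def PiE_iff inv_into_into f_inv_into_f extensional_def fun_eq_iff)
    with v sat show "\<exists>u\<in>{u \<in> ?I \<rightarrow>\<^sub>E A. qf_sat m u \<phi>}. v = (\<lambda>i\<in>?I. f (u i))"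
      by force
  qed
  from bij_betw_same_card[OF this] show ?thesis
    using assms by (simp add: stone_pairing_uniform_count_measure card_image)
qed

section \<open>Measurability of definable sets\<close>

text \<open>Off the diagonal, two points are separated by a small ball around a point of a countable
  dense set. So the complement of the diagonal is a countable union of measurable rectangles, a ball
  times its complement.\<close>

lemma standard_borel_diagonal:
  assumes "standard_borel M"
  shows "{p \<in> space (M \<Otimes>\<^sub>M M). fst p = snd p} \<in> sets (M \<Otimes>\<^sub>M M)"
proof -
  obtain X where X: "topspace X = space M" "completely_metrizable_space X" "separable_space X"
    "sets M = sigma_sets (topspace X) {U. openin X U}"
    using assms by (auto simp: standard_borel_def)
  obtain S d where "Metric_space S d" and Xd: "X = Metric_space.mtopology S d"
    using X(2) by (auto simp: completely_metrizable_space_def)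
  then interpret Metric_space S d by simp
  have S: "S = space M" using X(1) Xd by simp
  have ball: "mball c r \<in> sets M" for c r
    unfolding X(4) by (rule sigma_sets.Basic) (simp add: Xd)
  obtain C where C: "countable C" "C \<subseteq> S" "mtopology closure_of C = S"
    using X(3) Xd by (auto simp: separable_space_def)
  have "{p \<in> space (M \<Otimes>\<^sub>M M). fst p = snd p} =
    space (M \<Otimes>\<^sub>M M) - (\<Union>c\<in>C. \<Union>n::nat. mball c (1 / Suc n) \<times> (space M - mball c (1 / Suc n)))"
    (is "?D = ?E")
  proof (rule set_eqI)
    fix p
    show "p \<in> ?D \<longleftrightarrow> p \<in> ?E"
    proof (cases "p \<in> space (M \<Otimes>\<^sub>M M) \<and> fst p \<noteq> snd p")
      case True
      then have xy: "fst p \<in> S" "snd p \<in> S" "fst p \<noteq> snd p"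
        by (auto simp: space_pair_measure S)
      \<comment> \<open>With a radius below half the distance, a ball whose centre is within that
        radius of the first point cannot contain the second.\<close>
      then obtain n where n: "inverse (real (Suc n)) < d (fst p) (snd p) / 2"
        using reals_Archimedean[of "d (fst p) (snd p) / 2"] by auto
      have "\<forall>r>0. \<exists>c\<in>C. c \<in> mball (fst p) r"
        using xy(1) C(3) metric_closure_of[of C] by blast
      then have "\<exists>c\<in>C. c \<in> mball (fst p) (1 / Suc n)"
        by (elim allE impE) simp_all
      then obtain c where c: "c \<in> C" "d (fst p) c < 1 / Suc n"
        by auto
      then have "c \<in> S" using C(2) by auto
      moreover have "\<not> d c (snd p) < 1 / Suc n"
        using triangle[OF xy(1) \<open>c \<in> S\<close> xy(2)] c n by (simp add: inverse_eq_divide)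
      ultimately have "p \<in> mball c (1 / Suc n) \<times> (space M - mball c (1 / Suc n))"
        using xy c by (auto simp: mem_Times_iff commute S[symmetric])
      with c True show ?thesis by blast
    qed auto
  qed
  also have "\<dots> \<in> sets (M \<Otimes>\<^sub>M M)"
    using C(1) ball by (intro sets.Diff sets.top sets.countable_UN' pair_measureI) auto
  finally show ?thesis .
qed

lemma measurable_tm_val:
  assumes "borel_tree_semilattice M meet" "tm_vars t \<subseteq> I"
  shows "(\<lambda>v. tm_val meet v t) \<in> PiM I (\<lambda>_. M) \<rightarrow>\<^sub>M M"
  using assms(2)
proof (induction t)
  case (Meet s t)
  have "(\<lambda>(x, y). meet x y) \<in> M \<Otimes>\<^sub>M M \<rightarrow>\<^sub>M M"
    using assms(1) by (simp add: borel_tree_semilattice_def)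
  moreover have "(\<lambda>v. (tm_val meet v s, tm_val meet v t)) \<in> PiM I (\<lambda>_. M) \<rightarrow>\<^sub>M M \<Otimes>\<^sub>M M"
    using Meet by (intro measurable_Pair) auto
  ultimately show ?case
    using measurable_compose by fastforce
qed (auto intro: measurable_component_singleton)

text \<open>An equation defines the preimage of the diagonal under the pair of its term values;
  connectives are set operations.\<close>

lemma sets_qf_sat:
  assumes "borel_tree_semilattice M meet" "free_vars \<phi> \<subseteq> I"
  shows "{v \<in> space (PiM I (\<lambda>_. M)). qf_sat meet v \<phi>} \<in> sets (PiM I (\<lambda>_. M))"
  using assms(2)
proof (induction \<phi>)
  case (Eq s t)
  have "(\<lambda>v. (tm_val meet v s, tm_val meet v t)) \<in> PiM I (\<lambda>_. M) \<rightarrow>\<^sub>M M \<Otimes>\<^sub>M M"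
    using Eq assms(1) by (intro measurable_Pair measurable_tm_val) auto
  from measurable_sets[OF this standard_borel_diagonal] assms(1)
  have "(\<lambda>v. (tm_val meet v s, tm_val meet v t)) -` {p \<in> space (M \<Otimes>\<^sub>M M). fst p = snd p} \<inter> space (PiM I (\<lambda>_. M))
    \<in> sets (PiM I (\<lambda>_. M))"
    by (auto simp: borel_tree_semilattice_def)
  also have "(\<lambda>v. (tm_val meet v s, tm_val meet v t)) -` {p \<in> space (M \<Otimes>\<^sub>M M). fst p = snd p} \<inter> space (PiM I (\<lambda>_. M)) =
    {v \<in> space (PiM I (\<lambda>_. M)). qf_sat meet v (Eq s t)}"
    using measurable_space[OF measurable_tm_val[OF assms(1)]] Eq
    by (auto simp: space_pair_measure)
  finally show ?case .
next
  case (Neg \<phi>)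
  have "{v \<in> space (PiM I (\<lambda>_. M)). qf_sat meet v (Neg \<phi>)} =
    space (PiM I (\<lambda>_. M)) - {v \<in> space (PiM I (\<lambda>_. M)). qf_sat meet v \<phi>}"
    by auto
  then show ?case
    using Neg by (simp add: sets.compl_sets)
next
  case (Conj \<phi> \<psi>)
  then show ?case
    by (auto intro!: sets.sets_Collect_conj)
next
  case (Disj \<phi> \<psi>)
  then show ?case
    by (auto intro!: sets.sets_Collect_disj)
qed

section \<open>Second moment of the sample statistic\<close>

lemma card_injections:
  assumes "finite I" "finite C"
  shows "card {g \<in> I \<rightarrow>\<^sub>E C. inj_on g I} = (\<Prod>i<card I. card C - i)"
  using card_inj_on_subset_funcset[OF assms subset_refl] by (simp add: atLeast0LessThan)

text \<open>An element assigns to each variable a position in a sample of size \<open>N\<close>,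
  different variables getting different positions.\<close>

definition injections :: "'i set \<Rightarrow> nat \<Rightarrow> ('i \<Rightarrow> nat) set" where
  "injections I N = {g \<in> I \<rightarrow>\<^sub>E {..<N}. inj_on g I}"

text \<open>The proportion of injections among all maps from \<open>p\<close> variables to
  \<open>N\<close> positions. For \<open>0 < N < p\<close> truncated subtraction yields a zero
  factor, as it should.\<close>

definition inj_ratio :: "nat \<Rightarrow> nat \<Rightarrow> real" where
  "inj_ratio p N = (\<Prod>i<p. real (N - i) / real N)"

text \<open>The proportion, among all pairs of maps, of pairs of injections with disjoint images:
  the second one has only \<open>N - p\<close> positions left.\<close>

definition disjoint_ratio :: "nat \<Rightarrow> nat \<Rightarrow> real" where
  "disjoint_ratio p N = inj_ratio p N * (\<Prod>i<p. real (N - p - i) / real N)"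

lemma finite_injections [simp]: "finite I \<Longrightarrow> finite (injections I N)"
  unfolding injections_def by (rule finite_subset[OF _ finite_PiE[of I "\<lambda>_. {..<N}"]]) auto

lemma card_injections_ratio:
  assumes "finite I" "N > 0"
  shows "real (card (injections I N)) = inj_ratio (card I) N * real N ^ card I"
  using assms by (simp add: injections_def card_injections inj_ratio_def prod_dividef)

lemma card_disjoint_injections:
  assumes "finite I" "N > 0"
  shows "real (card {(g, h) \<in> injections I N \<times> injections I N. g ` I \<inter> h ` I = {}}) =
    disjoint_ratio (card I) N * real N ^ (2 * card I)"
proof -
  have "{(g, h) \<in> injections I N \<times> injections I N. g ` I \<inter> h ` I = {}} =
    Sigma (injections I N) (\<lambda>g. {h \<in> I \<rightarrow>\<^sub>E ({..<N} - g ` I). inj_on h I})"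
    by (auto simp: injections_def PiE_iff disjoint_iff) (metis imageI)
  moreover have "card {h \<in> I \<rightarrow>\<^sub>E ({..<N} - g ` I). inj_on h I} = (\<Prod>i<card I. N - card I - i)"
    if "g \<in> injections I N" for g
  proof -
    have "card ({..<N} - g ` I) = N - card I"
      using that assms by (subst card_Diff_subset) (auto simp: injections_def card_image)
    then show ?thesis
      using assms by (simp add: card_injections)
  qed
  moreover have fin: "finite {h \<in> I \<rightarrow>\<^sub>E ({..<N} - g ` I). inj_on h I}" for g
    using assms by (intro finite_subset[OF _ finite_PiE[of I "\<lambda>_. {..<N} - g ` I"]]) auto
  ultimately have "card {(g, h) \<in> injections I N \<times> injections I N. g ` I \<inter> h ` I = {}} =
    card (injections I N) * (\<Prod>i<card I. N - card I - i)"
    using assms fin by (simp add: card_SigmaI)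
  then show ?thesis
    using assms
    by (simp add: card_injections_ratio disjoint_ratio_def prod_dividef mult_2 power_add)
qed

lemma tendsto_diff_ratio: "(\<lambda>N. real (N - k) / real N) \<longlonglongrightarrow> 1"
proof -
  have "(\<lambda>N. 1 - real k * (1 / real N)) \<longlonglongrightarrow> 1 - real k * 0"
    by (intro tendsto_intros lim_1_over_n)
  moreover have "\<forall>\<^sub>F N in sequentially. 1 - real k * (1 / real N) = real (N - k) / real N"
    using eventually_ge_at_top[of "Suc k"] by eventually_elim (simp add: of_nat_diff field_simps)
  ultimately show ?thesis
    using Lim_transform_eventually by fastforce
qed

lemma inj_ratio_tendsto: "inj_ratio p \<longlonglongrightarrow> 1"
proof -
  have "(\<lambda>N. \<Prod>i<p. real (N - i) / real N) \<longlonglongrightarrow> (\<Prod>i<p. 1)"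
    by (intro tendsto_prod tendsto_diff_ratio)
  then show ?thesis by (simp add: inj_ratio_def[abs_def])
qed

lemma disjoint_ratio_tendsto: "disjoint_ratio p \<longlonglongrightarrow> 1"
proof -
  have "(\<lambda>N. \<Prod>i<p. real (N - (p + i)) / real N) \<longlonglongrightarrow> (\<Prod>i<p. 1)"
    by (intro tendsto_prod tendsto_diff_ratio)
  from tendsto_mult[OF inj_ratio_tendsto[of p] this] show ?thesis
    by (simp add: disjoint_ratio_def[abs_def])
qed

lemma inj_ratio_nonneg: "inj_ratio p N \<ge> 0"
  by (auto simp: inj_ratio_def intro!: prod_nonneg)

lemma inj_ratio_le_1: "inj_ratio p N \<le> 1"
  unfolding inj_ratio_def by (rule prod_le_1) (auto simp: divide_le_eq_1)

text \<open>A U-statistic, normalised by all \<open>N ^ card I\<close> index choices and not only by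
  the injective ones. Its mean is therefore \<open>inj_ratio (card I) N\<close> times the measure of
  \<open>B\<close>, slightly biased, but its denominator is that of a pairing over \<open>N\<close>
  points.\<close>

definition ustat :: "'i set \<Rightarrow> ('i \<Rightarrow> 'a) set \<Rightarrow> nat \<Rightarrow> (nat \<Rightarrow> 'a) \<Rightarrow> real" where
  "ustat I B N \<omega> = card {g \<in> injections I N. (\<lambda>i\<in>I. \<omega> (g i)) \<in> B} / real N ^ card I"

section \<open>Independent samples and the variance bound\<close>

context prob_space
begin

abbreviation samples :: "(nat \<Rightarrow> 'a) measure" where
  "samples \<equiv> PiM UNIV (\<lambda>_. M)"

lemma prob_space_samples: "prob_space samples"
  by (rule prob_space_PiM) (rule prob_space_axioms)

text \<open>Each reindexed tuple is a function of the coordinates in its own index set, and blocks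
  of independent coordinates over disjoint index sets are independent.\<close>

lemma indep_samples:
  fixes g h :: "'i \<Rightarrow> nat"
  assumes "g ` I \<inter> h ` J = {}"
  shows "prob_space.indep_var samples
    (PiM I (\<lambda>_. M)) (\<lambda>\<omega>. \<lambda>i\<in>I. \<omega> (g i)) (PiM J (\<lambda>_. M)) (\<lambda>\<omega>. \<lambda>j\<in>J. \<omega> (h j))"
proof -
  interpret S: prob_space samples by (rule prob_space_samples)
  have "S.indep_vars (\<lambda>_. M) (\<lambda>i \<omega>. \<omega> i) UNIV"
  proof (subst S.indep_vars_iff_distr_eq_PiM')
    have "distr samples M (\<lambda>\<omega>. \<omega> i) = M" for i
      by (rule distr_PiM_component) (auto intro: prob_space_axioms)
    then show "distr samples samples (\<lambda>x. \<lambda>i\<in>UNIV. x i) = PiM UNIV (\<lambda>i. distr samples M (\<lambda>\<omega>. \<omega> i))"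
      by (simp add: restrict_UNIV)
  qed (auto intro: measurable_component_singleton)
  then have "S.indep_var (PiM (g ` I) (\<lambda>_. M)) (\<lambda>\<omega>. restrict \<omega> (g ` I)) (PiM (h ` J) (\<lambda>_. M)) (\<lambda>\<omega>. restrict \<omega> (h ` J))"
    using S.indep_var_restrict[of "\<lambda>_. M" "\<lambda>i \<omega>. \<omega> i" UNIV "g ` I" "h ` J"] assms by simp
  moreover have "(\<lambda>\<omega>. \<lambda>i\<in>I. \<omega> (g i)) \<in> PiM (g ` I) (\<lambda>_. M) \<rightarrow>\<^sub>M PiM I (\<lambda>_. M)"
    by (intro measurable_restrict measurable_component_singleton) auto
  moreover have "(\<lambda>\<omega>. \<lambda>j\<in>J. \<omega> (h j)) \<in> PiM (h ` J) (\<lambda>_. M) \<rightarrow>\<^sub>M PiM J (\<lambda>_. M)"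
    by (intro measurable_restrict measurable_component_singleton) auto
  ultimately have "S.indep_var (PiM I (\<lambda>_. M)) ((\<lambda>\<omega>. \<lambda>i\<in>I. \<omega> (g i)) \<circ> (\<lambda>\<omega>. restrict \<omega> (g ` I)))
     (PiM J (\<lambda>_. M)) ((\<lambda>\<omega>. \<lambda>j\<in>J. \<omega> (h j)) \<circ> (\<lambda>\<omega>. restrict \<omega> (h ` J)))"
    by (rule S.indep_var_compose)
  moreover have "(\<lambda>\<omega>. \<lambda>i\<in>I. \<omega> (g i)) \<circ> (\<lambda>\<omega> :: nat \<Rightarrow> 'a. restrict \<omega> (g ` I)) = (\<lambda>\<omega>. \<lambda>i\<in>I. \<omega> (g i))"
    by (auto simp: fun_eq_iff restrict_def)
  moreover have "(\<lambda>\<omega>. \<lambda>j\<in>J. \<omega> (h j)) \<circ> (\<lambda>\<omega> :: nat \<Rightarrow> 'a. restrict \<omega> (h ` J)) = (\<lambda>\<omega>. \<lambda>j\<in>J. \<omega> (h j))"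
    by (auto simp: fun_eq_iff restrict_def)
  ultimately show ?thesis by (simp only:)
qed

lemma measurable_reindex: "(\<lambda>\<omega>. \<lambda>i\<in>I. \<omega> (g i)) \<in> samples \<rightarrow>\<^sub>M PiM I (\<lambda>_. M)"
  by (intro measurable_restrict measurable_component_singleton) auto

text \<open>An injective \<open>g\<close> repeats no coordinate, so the chosen subsample is again
  distributed as the product measure.\<close>

lemma measure_reindex:
  assumes "inj_on g I" "B \<in> sets (PiM I (\<lambda>_. M))"
  shows "measure samples ((\<lambda>\<omega>. \<lambda>i\<in>I. \<omega> (g i)) -` B \<inter> space samples) = measure (PiM I (\<lambda>_. M)) B"
proof -
  have "distr samples (PiM I (\<lambda>_. M)) (\<lambda>\<omega>. \<lambda>i\<in>I. \<omega> (g i)) = PiM I (\<lambda>_. M)"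
    using distr_PiM_reindex[of UNIV "\<lambda>_. M" g I] assms prob_space_axioms by simp
  then show ?thesis
    using measure_distr[OF measurable_reindex assms(2), of g] by simp
qed

text \<open>The moment is taken about the limit value \<open>c\<close>, not about the mean. In the
  expanded square, pairs of choices with disjoint images contribute exactly \<open>c\<^sup>2\<close>
  by independence, all other pairs at most 1. The terms with \<open>inj_ratio\<close> account for
  the bias of the mean.\<close>

lemma ustat_second_moment:
  assumes I: "finite I" and B: "B \<in> sets (PiM I (\<lambda>_. M))" and N: "N > 0"
  defines "c \<equiv> measure (PiM I (\<lambda>_. M)) B"
  shows "integrable samples (\<lambda>\<omega>. (ustat I B N \<omega> - c)\<^sup>2)"
    and "(\<integral>\<omega>. (ustat I B N \<omega> - c)\<^sup>2 \<partial>samples) \<le> (1 - disjoint_ratio (card I) N) + 2 * (1 - inj_ratio (card I) N)"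
proof -
  interpret S: prob_space samples by (rule prob_space_samples)
  interpret P: prob_space "PiM I (\<lambda>_. M)" by (rule prob_space_PiM) (rule prob_space_axioms)
  define p where "p = card I"
  define E where "E g = (\<lambda>\<omega>. \<lambda>i\<in>I. \<omega> (g i)) -` B \<inter> space samples" for g :: "'b \<Rightarrow> nat"
  define J where "J = injections I N"
  define D where "D = {(g, h) \<in> J \<times> J. g ` I \<inter> h ` I = {}}"
  have fin [simp]: "finite J" using I by (simp add: J_def)
  have E_sets [measurable]: "E g \<in> S.events" for g
    unfolding E_def by (rule measurable_sets[OF measurable_reindex B])
  have prob_E: "S.prob (E g) = c" if "g \<in> J" for g
    using that B unfolding E_def c_def by (intro measure_reindex) (auto simp: J_def injections_def)
  have prob_E2: "S.prob (E g \<inter> E h) = c\<^sup>2" if "(g, h) \<in> D" for g h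
  proof -
    have "E g \<inter> E h = (\<lambda>\<omega>. (\<lambda>i\<in>I. \<omega> (g i), \<lambda>i\<in>I. \<omega> (h i))) -` (B \<times> B) \<inter> space samples"
      by (auto simp: E_def)
    then have "S.prob (E g \<inter> E h) = S.prob (E g) * S.prob (E h)"
      using S.indep_varD[OF indep_samples[of g I h I] B B] that by (auto simp: E_def D_def)
    then show ?thesis
      using that by (simp add: prob_E D_def power2_eq_square)
  qed
  have c: "0 \<le> c" "c \<le> 1" by (simp_all add: c_def)
  have card_J: "real (card J) = inj_ratio p N * real N ^ p"
    using I N by (simp add: J_def p_def card_injections_ratio)
  have card_D: "real (card D) = disjoint_ratio p N * real N ^ (2 * p)"
    using I N unfolding D_def J_def p_def by (rule card_disjoint_injections)
  have N_pos: "real N ^ p > 0" "real N ^ (2 * p) > 0"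
    using N by simp_all
  let ?U = "\<lambda>\<omega>. (\<Sum>g\<in>J. indicator (E g) \<omega>) / real N ^ p"
  \<comment> \<open>The expanded square, written linearly in indicators so that its integral becomes
    a combination of probabilities.\<close>
  let ?V = "\<lambda>\<omega>. (\<Sum>x\<in>J \<times> J. indicator (E (fst x) \<inter> E (snd x)) \<omega>) / real N ^ (2 * p) - 2 * c * ?U \<omega> + c\<^sup>2"
  have U: "ustat I B N \<omega> = ?U \<omega>" if "\<omega> \<in> space samples" for \<omega>
  proof -
    have "(\<Sum>g\<in>J. indicator (E g) \<omega>) = real (card {g \<in> J. \<omega> \<in> E g})"
      using fin by (simp add: indicator_def sum.If_cases Int_def)
    then show ?thesis
      using that by (simp add: ustat_def J_def E_def p_def)
  qed
  have V: "(ustat I B N \<omega> - c)\<^sup>2 = ?V \<omega>" if "\<omega> \<in> space samples" for \<omega>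
  proof -
    have "(?U \<omega>)\<^sup>2 = (\<Sum>g\<in>J. \<Sum>h\<in>J. indicator (E g) \<omega> * indicator (E h) \<omega>) / real N ^ (2 * p)"
      by (simp add: power2_eq_square sum_product mult_2 power_add)
    also have "\<dots> = (\<Sum>x\<in>J \<times> J. indicator (E (fst x) \<inter> E (snd x)) \<omega>) / real N ^ (2 * p)"
      by (simp only: sum.cartesian_product indicator_inter_arith case_prod_unfold)
    finally show ?thesis
      using U[OF that] by (simp add: power2_diff algebra_simps)
  qed
  have int: "integrable samples (\<lambda>\<omega>. indicator (E g) \<omega> :: real)"
    "integrable samples (\<lambda>\<omega>. indicator (E g \<inter> E h) \<omega> :: real)" for g h
    using S.emeasure_finite by (auto simp: less_top[symmetric] intro!: integrable_real_indicator)
  have "integrable samples ?V"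
    using int
    by (intro Bochner_Integration.integrable_add Bochner_Integration.integrable_diff
        Bochner_Integration.integrable_mult_right Bochner_Integration.integrable_divide
        Bochner_Integration.integrable_sum) auto
  then show "integrable samples (\<lambda>\<omega>. (ustat I B N \<omega> - c)\<^sup>2)"
    by (subst Bochner_Integration.integrable_cong[OF refl V])
  \<comment> \<open>Overlapping pairs get the trivial bound 1; they are a vanishing fraction of all
    pairs.\<close>
  have "(\<Sum>x\<in>J \<times> J. S.prob (E (fst x) \<inter> E (snd x))) \<le> (\<Sum>x\<in>J \<times> J. if x \<in> D then c\<^sup>2 else 1)"
    using prob_E2 by (intro sum_mono) auto
  also have "\<dots> = c\<^sup>2 * card D + ((real (card J))\<^sup>2 - card D)"
  proof -
    have D: "D \<subseteq> J \<times> J" "finite D"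
      by (auto simp: D_def intro: finite_subset[of _ "J \<times> J"])
    have "(\<Sum>x\<in>J \<times> J. if x \<in> D then c\<^sup>2 else 1) = (\<Sum>x\<in>D. c\<^sup>2) + (\<Sum>x\<in>J \<times> J - D. 1)"
      using D by (subst sum.If_cases) (auto simp: Int_absorb1 Diff_eq)
    moreover have "real (card (J \<times> J - D)) = (real (card J))\<^sup>2 - card D"
      using D card_mono[of "J \<times> J" D] by (simp add: card_Diff_subset of_nat_diff card_cartesian_product power2_eq_square)
    ultimately show ?thesis by simp
  qed
  also have "\<dots> \<le> c\<^sup>2 * real N ^ (2 * p) + (1 - disjoint_ratio p N) * real N ^ (2 * p)"
  proof -
    have "real (card J) \<le> real N ^ p"
      using mult_right_mono[OF inj_ratio_le_1[of p N], of "real N ^ p"] card_J by simp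
    then have J2: "(real (card J))\<^sup>2 \<le> real N ^ (2 * p)"
      using power_mono[of "real (card J)" "real N ^ p" 2] by (simp add: power_mult[symmetric] mult.commute)
    have "card D \<le> (card J)\<^sup>2"
      using card_mono[of "J \<times> J" D] by (auto simp: D_def card_cartesian_product power2_eq_square)
    then have "real (card D) \<le> (real (card J))\<^sup>2"
      by (metis of_nat_le_iff of_nat_power)
    with J2 have "real (card D) \<le> real N ^ (2 * p)"
      by linarith
    then have "c\<^sup>2 * real (card D) \<le> c\<^sup>2 * real N ^ (2 * p)"
      by (rule mult_left_mono) simp
    with J2 show ?thesis
      by (simp add: card_D algebra_simps)
  qed
  finally have second: "(\<Sum>x\<in>J \<times> J. S.prob (E (fst x) \<inter> E (snd x))) / real N ^ (2 * p) \<le> c\<^sup>2 + (1 - disjoint_ratio p N)"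
    using N_pos by (simp add: divide_le_eq distrib_right)
  have first: "(\<Sum>g\<in>J. S.prob (E g)) / real N ^ p = inj_ratio p N * c"
    using N by (simp add: prob_E card_J)
  have "(\<integral>\<omega>. (ustat I B N \<omega> - c)\<^sup>2 \<partial>samples) = (\<integral>\<omega>. ?V \<omega> \<partial>samples)"
    using V by (intro Bochner_Integration.integral_cong) auto
  also have "\<dots> =
    (\<Sum>x\<in>J \<times> J. S.prob (E (fst x) \<inter> E (snd x))) / real N ^ (2 * p) - 2 * c * ((\<Sum>g\<in>J. S.prob (E g)) / real N ^ p) + c\<^sup>2"
    using int by (simp add: Bochner_Integration.integral_sum S.prob_space)
  also have "\<dots> \<le> c\<^sup>2 + (1 - disjoint_ratio p N) - 2 * c * (inj_ratio p N * c) + c\<^sup>2"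
    unfolding first using second by simp
  also have "\<dots> = (1 - disjoint_ratio p N) + 2 * (c\<^sup>2 * (1 - inj_ratio p N))"
    by (simp add: algebra_simps power2_eq_square)
  also have "\<dots> \<le> (1 - disjoint_ratio p N) + 2 * (1 - inj_ratio p N)"
    using mult_right_mono[of "c\<^sup>2" 1 "1 - inj_ratio p N"] c inj_ratio_le_1[of p N] by (simp add: power_le_one)
  finally show "(\<integral>\<omega>. (ustat I B N \<omega> - c)\<^sup>2 \<partial>samples) \<le> (1 - disjoint_ratio (card I) N) + 2 * (1 - inj_ratio (card I) N)"
    unfolding p_def .
qed

end

section \<open>Generic samples and their blow-ups\<close>

text \<open>The case \<open>i = j\<close> is included on purpose: with idempotence it makes the
  points pairwise distinct.\<close>

definition generic :: "('a \<Rightarrow> 'a \<Rightarrow> 'a) \<Rightarrow> (nat \<Rightarrow> 'a) \<Rightarrow> bool" where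
  "generic m w \<longleftrightarrow> (\<forall>i j k. k \<noteq> i \<longrightarrow> k \<noteq> j \<longrightarrow> m (w i) (w j) \<noteq> w k)"

text \<open>For fixed indices, \<open>\<omega> k\<close> is independent of the meet of the other two
  points, so Fubini reduces the probability of a coincidence to the measures of singletons, which
  vanish. There are only countably many triples of indices.\<close>

lemma (in prob_space) AE_generic:
  assumes "borel_tree_semilattice M meet" "atomless M"
  shows "AE \<omega> in samples. generic meet \<omega>"
proof -
  interpret S: prob_space samples by (rule prob_space_samples)
  have meas: "(\<lambda>(x, y). meet x y) \<in> M \<Otimes>\<^sub>M M \<rightarrow>\<^sub>M M"
    using assms(1) by (simp add: borel_tree_semilattice_def)
  define D where "D = {p \<in> space (M \<Otimes>\<^sub>M M). fst p = snd p}"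
  have D: "D \<in> sets (M \<Otimes>\<^sub>M M)"
    using assms(1) unfolding D_def borel_tree_semilattice_def by (intro standard_borel_diagonal) simp
  have "AE \<omega> in samples. meet (\<omega> i) (\<omega> j) \<noteq> \<omega> k" if k: "k \<noteq> i" "k \<noteq> j" for i j k
  proof -
    let ?X = "\<lambda>\<omega>. meet (\<omega> i) (\<omega> j)"
    have "S.indep_var (PiM {i, j} (\<lambda>_. M)) (\<lambda>\<omega>. \<lambda>n\<in>{i, j}. \<omega> n) (PiM {k} (\<lambda>_. M)) (\<lambda>\<omega>. \<lambda>n\<in>{k}. \<omega> n)"
      using indep_samples[of "\<lambda>n. n" "{i, j}" "\<lambda>n. n" "{k}"] k by auto
    moreover have "?X \<in> PiM {i, j} (\<lambda>_. M) \<rightarrow>\<^sub>M M"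
      using measurable_compose[OF measurable_Pair meas, of "\<lambda>\<omega>. \<omega> i" "PiM {i, j} (\<lambda>_. M)" "\<lambda>\<omega>. \<omega> j"]
      by (simp add: measurable_component_singleton)
    moreover have "(\<lambda>\<omega>. \<omega> k) \<in> PiM {k} (\<lambda>_. M) \<rightarrow>\<^sub>M M"
      by (simp add: measurable_component_singleton)
    ultimately have "S.indep_var M (?X \<circ> (\<lambda>\<omega>. \<lambda>n\<in>{i, j}. \<omega> n)) M ((\<lambda>\<omega>. \<omega> k) \<circ> (\<lambda>\<omega>. \<lambda>n\<in>{k}. \<omega> n))"
      by (rule S.indep_var_compose)
    then have indep: "S.indep_var M ?X M (\<lambda>\<omega>. \<omega> k)"
      by (simp add: comp_def)
    then have X: "?X \<in> samples \<rightarrow>\<^sub>M M"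
      by (rule S.indep_var_rv1)
    have XY: "(\<lambda>\<omega>. (?X \<omega>, \<omega> k)) \<in> samples \<rightarrow>\<^sub>M M \<Otimes>\<^sub>M M"
      using S.indep_var_rv1[OF indep] S.indep_var_rv2[OF indep] by (rule measurable_Pair)
    have "distr samples M (\<lambda>\<omega>. \<omega> k) = M"
      by (rule distr_PiM_component) (auto intro: prob_space_axioms)
    \<comment> \<open>Independence makes the joint law a product measure, in which the sections of
      the diagonal \<open>D\<close> are singletons.\<close>
    then have "distr samples (M \<Otimes>\<^sub>M M) (\<lambda>\<omega>. (?X \<omega>, \<omega> k)) = distr samples M ?X \<Otimes>\<^sub>M M"
      using indep unfolding S.indep_var_distribution_eq by simp
    then have "emeasure samples ((\<lambda>\<omega>. (?X \<omega>, \<omega> k)) -` D \<inter> space samples) = emeasure (distr samples M ?X \<Otimes>\<^sub>M M) D"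
      using emeasure_distr[OF XY D] by simp
    also have "\<dots> = (\<integral>\<^sup>+ x. emeasure M (Pair x -` D) \<partial>distr samples M ?X)"
      using D by (intro emeasure_pair_measure_alt) (simp cong: sets_pair_measure_cong)
    also have "\<dots> = (\<integral>\<^sup>+ x. 0 \<partial>distr samples M ?X)"
    proof (rule nn_integral_cong)
      fix x assume "x \<in> space (distr samples M ?X)"
      then have "x \<in> space M" "Pair x -` D = {x}"
        by (auto simp: D_def space_pair_measure)
      then show "emeasure M (Pair x -` D) = 0"
        using assms(2) by (simp add: atomless_def)
    qed
    finally have "emeasure samples ((\<lambda>\<omega>. (?X \<omega>, \<omega> k)) -` D \<inter> space samples) = 0"
      by simp
    then show ?thesis
    proof (rule AE_I[rotated])
      show "(\<lambda>\<omega>. (?X \<omega>, \<omega> k)) -` D \<inter> space samples \<in> sets samples"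
        by (rule measurable_sets[OF XY D])
      show "{\<omega> \<in> space samples. \<not> meet (\<omega> i) (\<omega> j) \<noteq> \<omega> k} \<subseteq> (\<lambda>\<omega>. (?X \<omega>, \<omega> k)) -` D \<inter> space samples"
        using measurable_space[OF XY] by (auto simp: D_def)
    qed
  qed
  then show ?thesis
    unfolding generic_def AE_all_countable by (auto intro: AE_I2)
qed

text \<open>
  The chains of length \<open>N\<^sup>2\<close> over the \<open>N\<close> sampled points outweigh the at most \<open>N\<^sup>2\<close> meets.
\<close>

definition blowup :: "('a \<Rightarrow> 'a \<Rightarrow> 'a) \<Rightarrow> (nat \<Rightarrow> 'a) \<Rightarrow> nat \<Rightarrow> ('a \<times> nat) set" where
  "blowup m w N = pair_meets m (w ` {..<N}) \<times> {0} \<union> w ` {..<N} \<times> {..<N\<^sup>2}"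

context tree_semilattice
begin

lemma generic_inj:
  assumes "generic meet w" "range w \<subseteq> T"
  shows "inj w"
proof (rule injI, rule ccontr)
  fix i k assume "w i = w k" "i \<noteq> k"
  moreover have "w i \<sqinter>\<^sub>T w i = w i"
    using assms(2) by (intro meet_idem) auto
  ultimately show False
    using assms(1) unfolding generic_def by metis
qed

text \<open>For equal first components the maximum is one of the two labels, so the result is
  \<open>p\<close> or \<open>q\<close>. Otherwise it is \<open>p\<close>, \<open>q\<close>, or a
  pairwise meet with label 0, which the blow-up contains.\<close>

lemma blowup_closed:
  assumes w: "w ` {..<N} \<subseteq> T" and pq: "p \<in> blowup meet w N" "q \<in> blowup meet w N"
  shows "lex_meet meet p q \<in> blowup meet w N"
proof -
  let ?P = "pair_meets meet (w ` {..<N})"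
  have V: "w ` {..<N} \<subseteq> ?P"
  proof
    fix x assume x: "x \<in> w ` {..<N}"
    with w meet_idem[of x] show "x \<in> ?P"
      using pair_meetsI[OF x x, of meet] by auto
  qed
  then have "fst p \<in> ?P" "fst q \<in> ?P"
    using pq by (auto simp: blowup_def)
  then have P: "fst p \<sqinter>\<^sub>T fst q \<in> ?P"
    using pair_meets_closed[OF w] by blast
  show ?thesis
  proof (cases "fst p = fst q")
    case True
    then show ?thesis
      using pq by (auto simp: blowup_def lex_meet_def max_def)
  next
    case False
    then show ?thesis
      using pq P by (simp add: blowup_def lex_meet_def)
  qed
qed

lemma blowup_tree_semilattice:
  assumes "w ` {..<N} \<subseteq> T"
  shows "tree_semilattice (blowup meet w N) (lex_meet meet)"
proof (rule tree_semilattice.tree_semilattice_subset[OF lex_meet_tree_semilattice])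
  show "blowup meet w N \<subseteq> T \<times> UNIV"
    using assms pair_meets_subset[OF assms] by (auto simp: blowup_def)
qed (rule blowup_closed[OF assms])

lemma finite_blowup [simp]: "finite (blowup meet w N)"
  by (simp add: blowup_def pair_meets_def)

lemma card_blowup:
  assumes "inj_on w {..<N}"
  shows "N ^ 3 \<le> card (blowup meet w N)" "card (blowup meet w N) \<le> N ^ 3 + N\<^sup>2"
proof -
  have V: "card (w ` {..<N} \<times> {..<N\<^sup>2}) = N ^ 3"
    using assms by (simp add: card_cartesian_product card_image power3_eq_cube power2_eq_square)
  have "card (w ` {..<N} \<times> {..<N\<^sup>2}) \<le> card (blowup meet w N)"
    by (rule card_mono) (auto simp: blowup_def pair_meets_def)
  with V show "N ^ 3 \<le> card (blowup meet w N)" by simp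
  have "card (pair_meets meet (w ` {..<N})) \<le> card (w ` {..<N} \<times> w ` {..<N})"
    unfolding pair_meets_def by (rule card_image_le) simp
  also have "\<dots> = N\<^sup>2"
    using assms by (simp add: card_cartesian_product card_image power2_eq_square)
  finally have "card (pair_meets meet (w ` {..<N}) \<times> {0::nat}) \<le> N\<^sup>2"
    by (simp add: card_cartesian_product)
  with V show "card (blowup meet w N) \<le> N ^ 3 + N\<^sup>2"
    unfolding blowup_def by (intro order_trans[OF card_Un_le]) simp
qed

text \<open>A meet of sample points that equals \<open>w k\<close> must involve \<open>w k\<close>
  itself, by genericity. Then \<open>x\<close> or \<open>y\<close> lies below \<open>w k\<close>,
  while \<open>w k\<close> lies below both, so \<open>w k\<close> is one of them.\<close>

lemma generic_meet_trivial:
  assumes w: "generic meet w" "range w \<subseteq> T"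
    and xy: "x \<in> pair_meets meet (range w)" "y \<in> pair_meets meet (range w)" and k: "x \<sqinter>\<^sub>T y = w k"
  shows "x \<sqinter>\<^sub>T y \<in> {x, y}"
proof -
  obtain i j where x: "x = w i \<sqinter>\<^sub>T w j" using xy by (auto simp: pair_meets_def)
  obtain i' j' where y: "y = w i' \<sqinter>\<^sub>T w j'" using xy by (auto simp: pair_meets_def)
  have T: "w n \<in> T" for n using w by auto
  have xyT: "x \<in> T" "y \<in> T" using x y T meet_closed by auto
  \<comment> \<open>Closure is applied to these four points alone, so that genericity identifies
    \<open>k\<close> with an index occurring in \<open>x\<close> or \<open>y\<close>.\<close>
  define K where "K = {i, j, i', j'}"
  have "x \<sqinter>\<^sub>T y \<in> pair_meets meet (w ` K)"
    using T by (intro pair_meets_closed) (auto simp: x y K_def intro!: pair_meetsI)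
  then obtain a b where ab: "a \<in> K" "b \<in> K" "w k = w a \<sqinter>\<^sub>T w b"
    unfolding k by (auto simp: pair_meets_def)
  then have "k = a \<or> k = b"
    using w(1) unfolding generic_def by metis
  with ab have "k = i \<or> k = j \<or> k = i' \<or> k = j'"
    by (auto simp: K_def)
  then have "x \<sqinter>\<^sub>T w k = x \<or> y \<sqinter>\<^sub>T w k = y"
    unfolding x y using T meet_le1 meet_le2 by metis
  moreover have "w k \<sqinter>\<^sub>T x = w k" "w k \<sqinter>\<^sub>T y = w k"
    unfolding k[symmetric] using meet_le1[OF xyT] meet_le2[OF xyT] by simp_all
  ultimately show ?thesis
    using k meet_commute[OF xyT(1) T] meet_commute[OF xyT(2) T] by auto
qed

text \<open>Since \<open>g\<close> is injective, each sample point in use receives one label, and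
  attaching labels embeds the subsemilattice generated by these points into the lexicographic
  product.\<close>

lemma qf_sat_blowup:
  assumes w: "generic meet w" "range w \<subseteq> T" and g: "inj_on g (free_vars \<phi>)"
  shows "qf_sat (lex_meet meet) (\<lambda>i. (w (g i), a i)) \<phi> = qf_sat meet (\<lambda>i. w (g i)) \<phi>"
proof -
  let ?I = "free_vars \<phi>" and ?u = "\<lambda>i. w (g i)"
  define S where "S = pair_meets meet (?u ` ?I)"
  \<comment> \<open>Prescribed labels at the chosen sample points; the default 0 elsewhere is the
    label that \<open>lex_meet\<close> gives to new meets.\<close>
  define lab where "lab x = (if x \<in> ?u ` ?I then a (the_inv_into ?I ?u x) else 0)" for x
  have inj: "inj_on ?u ?I"
    using comp_inj_on[OF g inj_on_subset[OF generic_inj[OF w]]] by (simp add: comp_def)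
  have uT: "?u ` ?I \<subseteq> T" using w by auto
  have S_range: "S \<subseteq> pair_meets meet (range w)"
    by (auto simp: S_def pair_meets_def)
  have "qf_sat (lex_meet meet) (\<lambda>i. (w (g i), a i)) \<phi> = qf_sat (lex_meet meet) (\<lambda>i. (?u i, lab (?u i))) \<phi>"
    using inj by (intro qf_sat_cong) (simp add: lab_def the_inv_into_f_f[OF inj])
  also have "\<dots> = qf_sat meet ?u \<phi>"
  proof (rule qf_sat_embedding[where h = "\<lambda>x. (x, lab x)" and S = S])
    fix x y assume xy: "x \<in> S" "y \<in> S"
    then show "x \<sqinter>\<^sub>T y \<in> S"
      unfolding S_def by (rule pair_meets_closed[OF uT])
    \<comment> \<open>A meet different from both arguments is not a sample point, by genericity, so
      \<open>lab\<close> gives it the label 0 required by \<open>lex_meet\<close>.\<close>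
    have "x \<sqinter>\<^sub>T y \<notin> ?u ` ?I" if "x \<sqinter>\<^sub>T y \<noteq> x" "x \<sqinter>\<^sub>T y \<noteq> y"
      using generic_meet_trivial[OF w] xy S_range that by blast
    moreover have "x \<sqinter>\<^sub>T x = x"
      using xy(1) pair_meets_subset[OF uT] by (auto simp: S_def meet_idem)
    ultimately show "(x \<sqinter>\<^sub>T y, lab (x \<sqinter>\<^sub>T y)) = lex_meet meet (x, lab x) (y, lab y)"
      by (auto simp: lex_meet_def lab_def)
  next
    show "?u ` ?I \<subseteq> S"
    proof
      fix x assume x: "x \<in> ?u ` ?I"
      with uT meet_idem[of x] show "x \<in> S"
        using pair_meetsI[OF x x, of meet] by (auto simp: S_def)
    qed
  qed (simp add: inj_on_def)
  finally show ?thesis .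
qed

text \<open>Assignments by copies of distinct sample points are satisfying exactly when their index
  choice is counted by \<open>ustat\<close>. All other assignments are treated as error, bounded by
  their proportion.\<close>

lemma stone_pairing_blowup:
  assumes w: "generic meet w" "range w \<subseteq> T" and N: "N > 0"
    and B: "\<And>u. u \<in> free_vars \<phi> \<rightarrow>\<^sub>E range w \<Longrightarrow> u \<in> B \<longleftrightarrow> qf_sat meet u \<phi>"
  shows "\<bar>stone_pairing \<phi> (uniform_count_measure (blowup meet w N)) (lex_meet meet) - ustat (free_vars \<phi>) B N w\<bar>
    \<le> 1 - inj_ratio (card (free_vars \<phi>)) N * (real N / real (Suc N)) ^ card (free_vars \<phi>)"
proof -
  let ?I = "free_vars \<phi>"
  define p where "p = card ?I"
  define A where "A = blowup meet w N"
  define J where "J = injections ?I N"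
  define L where "L = ?I \<rightarrow>\<^sub>E {..<N\<^sup>2}"
  define F where "F = (\<lambda>(g, a). \<lambda>i\<in>?I. (w (g i), a i :: nat))"
  define U where "U = {u \<in> ?I \<rightarrow>\<^sub>E A. qf_sat (lex_meet meet) u \<phi>}"
  define G where "G = {g \<in> J. (\<lambda>i\<in>?I. w (g i)) \<in> B}"
  have inj_w: "inj w" by (rule generic_inj[OF w])
  have fin: "finite A" "finite J" "finite (?I \<rightarrow>\<^sub>E A)" "finite G"
    by (simp_all add: A_def J_def G_def finite_PiE)
  have A_card: "N ^ 3 \<le> card A" "card A \<le> N ^ 3 + N\<^sup>2"
    using card_blowup[of w N] inj_on_subset[OF inj_w] by (auto simp: A_def)
  then have A_pos: "real (card A) > 0" 
    using N by (metis of_nat_0_less_iff less_le_trans zero_less_power)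
  then have "A \<noteq> {}" by auto
  have F_inj: "inj_on F (J \<times> L)"
  proof (rule inj_onI, clarify)
    fix g a h b assume mem: "g \<in> J" "a \<in> L" "h \<in> J" "b \<in> L" and eq: "F (g, a) = F (h, b)"
    have "g i = h i \<and> a i = b i" if "i \<in> ?I" for i
      using fun_cong[OF eq, of i] that inj_eq[OF inj_w] by (simp add: F_def)
    moreover have "g \<in> extensional ?I" "h \<in> extensional ?I" "a \<in> extensional ?I" "b \<in> extensional ?I"
      using mem by (auto simp: J_def L_def injections_def PiE_iff)
    ultimately show "g = h \<and> a = b"
      by (meson extensionalityI)
  qed
  have F_mem: "F ` (J \<times> L) \<subseteq> ?I \<rightarrow>\<^sub>E A"
    by (auto simp: F_def J_def L_def A_def blowup_def injections_def PiE_iff)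
  have F_sat: "F (g, a) \<in> U \<longleftrightarrow> g \<in> G" if "g \<in> J" "a \<in> L" for g a
  proof -
    have "qf_sat (lex_meet meet) (F (g, a)) \<phi> = qf_sat (lex_meet meet) (\<lambda>i. (w (g i), a i)) \<phi>"
      by (rule qf_sat_cong) (simp add: F_def)
    also have "\<dots> = qf_sat meet (\<lambda>i. w (g i)) \<phi>"
      using that by (intro qf_sat_blowup w) (simp add: J_def injections_def)
    also have "\<dots> = qf_sat meet (\<lambda>i\<in>?I. w (g i)) \<phi>"
      by (rule qf_sat_cong) simp
    also have "\<dots> \<longleftrightarrow> (\<lambda>i\<in>?I. w (g i)) \<in> B"
      by (rule B[symmetric]) auto
    finally show ?thesis
      using F_mem that by (auto simp: U_def G_def)
  qed
  have card_F: "card (F ` (G \<times> L)) = card G * (N\<^sup>2) ^ p" "card (F ` (J \<times> L)) = card J * (N\<^sup>2) ^ p"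
  proof -
    have "inj_on F (G \<times> L)"
      by (rule inj_on_subset[OF F_inj]) (auto simp: G_def)
    with F_inj show "card (F ` (G \<times> L)) = card G * (N\<^sup>2) ^ p" "card (F ` (J \<times> L)) = card J * (N\<^sup>2) ^ p"
      by (simp_all add: card_image card_cartesian_product L_def card_PiE p_def)
  qed
  have U_lower: "card G * (N\<^sup>2) ^ p \<le> card U"
    unfolding card_F(1)[symmetric] using F_sat fin
    by (intro card_mono) (auto simp: U_def G_def)
  \<comment> \<open>Outside the image of \<open>F\<close> every assignment might be satisfying, so
    all of them are counted.\<close>
  have U_upper: "card U + card J * (N\<^sup>2) ^ p \<le> card G * (N\<^sup>2) ^ p + card A ^ p"
  proof -
    have "U \<subseteq> F ` (G \<times> L) \<union> ((?I \<rightarrow>\<^sub>E A) - F ` (J \<times> L))"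
    proof
      fix u assume u: "u \<in> U"
      show "u \<in> F ` (G \<times> L) \<union> ((?I \<rightarrow>\<^sub>E A) - F ` (J \<times> L))"
      proof (cases "u \<in> F ` (J \<times> L)")
        case True
        then obtain g a where ga: "u = F (g, a)" "g \<in> J" "a \<in> L" by blast
        with u F_sat have "g \<in> G" by blast
        with ga show ?thesis by blast
      qed (use u in \<open>simp add: U_def\<close>)
    qed
    then have "card U \<le> card (F ` (G \<times> L) \<union> ((?I \<rightarrow>\<^sub>E A) - F ` (J \<times> L)))"
      using fin by (intro card_mono) (simp_all add: L_def finite_PiE)
    also have "\<dots> \<le> card (F ` (G \<times> L)) + card ((?I \<rightarrow>\<^sub>E A) - F ` (J \<times> L))"
      by (rule card_Un_le)
    also have "card ((?I \<rightarrow>\<^sub>E A) - F ` (J \<times> L)) = card A ^ p - card (F ` (J \<times> L))"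
      using card_Diff_subset[OF finite_subset[OF F_mem fin(3)] F_mem] by (simp add: card_PiE p_def)
    finally have "card U \<le> card G * (N\<^sup>2) ^ p + (card A ^ p - card J * (N\<^sup>2) ^ p)"
      by (simp only: card_F)
    moreover have "card J * (N\<^sup>2) ^ p \<le> card A ^ p"
      using card_mono[OF fin(3) F_mem] by (simp add: card_F(2) card_PiE p_def)
    ultimately show ?thesis by linarith
  qed
  \<comment> \<open>\<open>\<gamma>\<close> is the sample statistic, \<open>r\<close> the proportion
    of injective index choices, \<open>s\<close> the proportion of assignments with all values in
    the chains, and \<open>t\<close> the pairing of the blow-up.\<close>
  define \<gamma> where "\<gamma> = card G / real N ^ p"
  define r where "r = inj_ratio p N"
  define s where "s = (real N ^ 3 / card A) ^ p"
  define t where "t = card U / real (card A) ^ p"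
  have NK: "(real N)\<^sup>2 ^ p * real N ^ p = (real N ^ 3) ^ p"
    unfolding power_mult_distrib[symmetric] by (simp add: power3_eq_cube power2_eq_square)
  have J_card: "real (card J) = r * real N ^ p"
    using N by (simp add: J_def r_def p_def card_injections_ratio)
  have G_s: "real (card G) * (real N)\<^sup>2 ^ p / real (card A) ^ p = \<gamma> * s"
    using N NK[symmetric] by (simp add: \<gamma>_def s_def power_divide)
  have J_s: "real (card J) * (real N)\<^sup>2 ^ p / real (card A) ^ p = r * s"
    using NK[symmetric] by (simp add: J_card s_def power_divide)
  have "real (card G) * (real N)\<^sup>2 ^ p \<le> real (card U)"
    using U_lower by (simp flip: of_nat_power of_nat_mult)
  from divide_right_mono[OF this, of "real (card A) ^ p"] have t_lower: "\<gamma> * s \<le> t"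
    by (simp add: G_s t_def)
  have "real (card U) + real (card J) * (real N)\<^sup>2 ^ p \<le> real (card G) * (real N)\<^sup>2 ^ p + real (card A) ^ p"
    using U_upper by (simp flip: of_nat_power of_nat_mult of_nat_add)
  from divide_right_mono[OF this, of "real (card A) ^ p"] have t_upper: "t + r * s \<le> \<gamma> * s + 1"
    using A_pos by (simp add: G_s J_s t_def add_divide_distrib)
  have s_le: "s \<le> 1"
    using A_card(1) A_pos unfolding s_def by (intro power_le_one) (auto simp: divide_le_eq_1 simp flip: of_nat_power)
  \<comment> \<open>The meets add at most \<open>N\<^sup>2\<close> points to the
    \<open>N ^ 3\<close> chain points, which leaves a proportion of at least
    \<open>N / Suc N\<close> per variable.\<close>
  have s_ge: "(real N / real (Suc N)) ^ p \<le> s"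
    unfolding s_def
  proof (rule power_mono)
    have "real (card A) \<le> real N ^ 3 + (real N)\<^sup>2"
      using A_card(2) by (simp flip: of_nat_power of_nat_add)
    then have "real N * card A \<le> real N * (real N ^ 3 + (real N)\<^sup>2)"
      by (intro mult_left_mono) auto
    also have "\<dots> = real N ^ 3 * real (Suc N)"
      by (simp add: power3_eq_cube power2_eq_square algebra_simps)
    finally show "real N / real (Suc N) \<le> real N ^ 3 / real (card A)"
      using A_pos by (simp add: divide_simps)
  qed simp
  have r: "0 \<le> r" "r \<le> 1"
    by (simp_all add: r_def inj_ratio_nonneg inj_ratio_le_1)
  have "card G \<le> card J"
    using fin by (intro card_mono) (auto simp: G_def)
  then have \<gamma>: "0 \<le> \<gamma>" "\<gamma> \<le> r"
    using N by (simp_all add: \<gamma>_def divide_le_eq flip: J_card)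
  \<comment> \<open>The value \<open>t\<close> lies between \<open>\<gamma> * s\<close> and
    \<open>\<gamma> * s + 1 - r * s\<close>. Moreover \<open>\<gamma>\<close> exceeds the lower end
    by \<open>\<gamma> * (1 - s)\<close>, which is at most \<open>r * (1 - s)\<close> and so at most
    \<open>1 - r * s\<close>.\<close>
  have "\<gamma> * (1 - s) \<le> r * (1 - s)"
    using \<gamma> s_le by (intro mult_right_mono) auto
  moreover have "\<gamma> * (1 - s) \<ge> 0"
    using \<gamma> s_le by simp
  ultimately have "\<bar>t - \<gamma>\<bar> \<le> 1 - r * s"
    using t_lower t_upper r by (simp add: abs_le_iff algebra_simps)
  also have "\<dots> \<le> 1 - r * (real N / real (Suc N)) ^ p"
    using mult_left_mono[OF s_ge r(1)] by simp
  finally have "\<bar>t - \<gamma>\<bar> \<le> 1 - r * (real N / real (Suc N)) ^ p" .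
  moreover have "t = stone_pairing \<phi> (uniform_count_measure A) (lex_meet meet)"
    using fin(1) \<open>A \<noteq> {}\<close> by (simp add: stone_pairing_uniform_count_measure t_def U_def p_def)
  moreover have "\<gamma> = ustat ?I B N w"
    by (simp add: \<gamma>_def ustat_def G_def J_def p_def)
  ultimately show ?thesis
    by (simp add: A_def p_def r_def)
qed

end

section \<open>Simultaneous approximation and the diagonal choice\<close>

instance tm :: countable
  by countable_datatype

instance qf :: countable
  by countable_datatype

text \<open>Half of \<open>\<epsilon>\<close> pays for passing from the sample statistic to the
  blow-up, the other half for the deviation of the statistic from the pairing with \<open>M\<close>.
  A single large \<open>N\<close> serves all formulas in the finite set.\<close>

lemma blowup_approximation:
  assumes tree: "borel_tree_semilattice M meet" and M: "prob_space M" and atomless: "atomless M"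
    and \<Phi>: "finite \<Phi>" and \<epsilon>: "\<epsilon> > 0"
  shows "\<exists>N w. N > 0 \<and> range w \<subseteq> space M \<and>
    (\<forall>\<phi>\<in>\<Phi>. \<bar>stone_pairing \<phi> (uniform_count_measure (blowup meet w N)) (lex_meet meet) - stone_pairing \<phi> M meet\<bar> < \<epsilon>)"
proof -
  interpret prob_space M by fact
  interpret S: prob_space samples by (rule prob_space_samples)
  interpret tree_semilattice "space M" meet
    using tree by (simp add: borel_tree_semilattice_def)
  define p where "p \<phi> = card (free_vars \<phi>)" for \<phi>
  define B where "B \<phi> = {v \<in> space (PiM (free_vars \<phi>) (\<lambda>_. M)). qf_sat meet v \<phi>}" for \<phi>
  have B_sets: "B \<phi> \<in> sets (PiM (free_vars \<phi>) (\<lambda>_. M))" for \<phi>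
    unfolding B_def by (rule sets_qf_sat[OF tree]) simp
  have c: "stone_pairing \<phi> M meet = measure (PiM (free_vars \<phi>) (\<lambda>_. M)) (B \<phi>)" for \<phi>
    by (simp add: stone_pairing_def B_def Let_def)
  have ratio: "(\<lambda>N. real N / real (Suc N)) \<longlonglongrightarrow> 1"
    by (rule LIMSEQ_n_over_Suc_n)
  have "(\<lambda>N. 1 - inj_ratio (p \<phi>) N * (real N / real (Suc N)) ^ p \<phi>) \<longlonglongrightarrow> 1 - 1 * 1 ^ p \<phi>" for \<phi>
    by (intro tendsto_intros ratio inj_ratio_tendsto)
  then have ev_bias: "\<forall>\<^sub>F N in sequentially. \<forall>\<phi>\<in>\<Phi>. 1 - inj_ratio (p \<phi>) N * (real N / real (Suc N)) ^ p \<phi> < \<epsilon> / 2"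
    using \<epsilon> \<Phi> by (intro eventually_ball_finite ballI order_tendstoD(2)[where y = 0]) auto
  have "(\<lambda>N. \<Sum>\<phi>\<in>\<Phi>. (1 - disjoint_ratio (p \<phi>) N) + 2 * (1 - inj_ratio (p \<phi>) N)) \<longlonglongrightarrow>
    (\<Sum>\<phi>\<in>\<Phi>. (1 - 1) + 2 * (1 - 1))"
    by (intro tendsto_intros inj_ratio_tendsto disjoint_ratio_tendsto)
  then have ev_variance: "\<forall>\<^sub>F N in sequentially. (\<Sum>\<phi>\<in>\<Phi>. (1 - disjoint_ratio (p \<phi>) N) + 2 * (1 - inj_ratio (p \<phi>) N)) < (\<epsilon> / 2)\<^sup>2"
    using \<epsilon> by (intro order_tendstoD(2)[where y = "\<Sum>\<phi>\<in>\<Phi>. (1 - 1) + 2 * (1 - 1)"]) auto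
  obtain N where N: "N > 0"
      "\<And>\<phi>. \<phi> \<in> \<Phi> \<Longrightarrow> 1 - inj_ratio (p \<phi>) N * (real N / real (Suc N)) ^ p \<phi> < \<epsilon> / 2"
      "(\<Sum>\<phi>\<in>\<Phi>. (1 - disjoint_ratio (p \<phi>) N) + 2 * (1 - inj_ratio (p \<phi>) N)) < (\<epsilon> / 2)\<^sup>2"
    using eventually_happens'[OF sequentially_bot
        eventually_conj[OF eventually_gt_at_top[of 0] eventually_conj[OF ev_bias ev_variance]]]
    by blast
  \<comment> \<open>Summing the squared deviations lets one sample be good for all formulas at once:
    a bound on the sum bounds each summand.\<close>
  define X where "X w = (\<Sum>\<phi>\<in>\<Phi>. (ustat (free_vars \<phi>) (B \<phi>) N w - stone_pairing \<phi> M meet)\<^sup>2)" for w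
  have moment: "integrable samples (\<lambda>w. (ustat (free_vars \<phi>) (B \<phi>) N w - stone_pairing \<phi> M meet)\<^sup>2)"
    "(\<integral>w. (ustat (free_vars \<phi>) (B \<phi>) N w - stone_pairing \<phi> M meet)\<^sup>2 \<partial>samples) \<le>
      (1 - disjoint_ratio (p \<phi>) N) + 2 * (1 - inj_ratio (p \<phi>) N)" for \<phi>
    unfolding c p_def using B_sets N(1) by (intro ustat_second_moment; simp)+
  have X_int: "integrable samples X"
    unfolding X_def using moment(1) by (intro Bochner_Integration.integrable_sum)
  have "(\<integral>w. X w \<partial>samples) \<le> (\<Sum>\<phi>\<in>\<Phi>. (1 - disjoint_ratio (p \<phi>) N) + 2 * (1 - inj_ratio (p \<phi>) N))"
    unfolding X_def using moment by (subst Bochner_Integration.integral_sum) (auto intro: sum_mono)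
  with N(3) have X_small: "(\<integral>w. X w \<partial>samples) < (\<epsilon> / 2)\<^sup>2" by simp
  \<comment> \<open>If every generic sample had a large \<open>X\<close>, then \<open>X\<close>
    would be large almost everywhere, and so would its mean.\<close>
  have "\<exists>w\<in>space samples. generic meet w \<and> X w < (\<epsilon> / 2)\<^sup>2"
  proof (rule ccontr)
    assume "\<not> ?thesis"
    then have large: "(\<epsilon> / 2)\<^sup>2 \<le> X w" if "w \<in> space samples" "generic meet w" for w
      using that by force
    have "AE w in samples. (\<epsilon> / 2)\<^sup>2 \<le> X w"
      using AE_generic[OF tree atomless] AE_space by eventually_elim (rule large)
    from S.integral_ge_const[OF X_int this] X_small show False by simp
  qed
  then obtain w where w: "w \<in> space samples" "generic meet w" "X w < (\<epsilon> / 2)\<^sup>2" by blast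
  have w_range: "range w \<subseteq> space M" using w(1) by (auto simp: space_PiM)
  have "\<bar>stone_pairing \<phi> (uniform_count_measure (blowup meet w N)) (lex_meet meet) - stone_pairing \<phi> M meet\<bar> < \<epsilon>"
    if "\<phi> \<in> \<Phi>" for \<phi>
  proof -
    have "(ustat (free_vars \<phi>) (B \<phi>) N w - stone_pairing \<phi> M meet)\<^sup>2 \<le> X w"
      unfolding X_def using \<Phi> that by (intro member_le_sum) auto
    with w(3) have "\<bar>ustat (free_vars \<phi>) (B \<phi>) N w - stone_pairing \<phi> M meet\<bar>\<^sup>2 < (\<epsilon> / 2)\<^sup>2"
      by simp
    then have "\<bar>ustat (free_vars \<phi>) (B \<phi>) N w - stone_pairing \<phi> M meet\<bar> < \<epsilon> / 2"
      by (rule power2_less_imp_less) (use \<epsilon> in simp)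
    moreover have "\<bar>stone_pairing \<phi> (uniform_count_measure (blowup meet w N)) (lex_meet meet) -
        ustat (free_vars \<phi>) (B \<phi>) N w\<bar> \<le> 1 - inj_ratio (p \<phi>) N * (real N / real (Suc N)) ^ p \<phi>"
      unfolding p_def using w_range
      by (intro stone_pairing_blowup w w_range N) (auto simp: B_def space_PiM PiE_iff)
    ultimately show ?thesis using N(2)[OF that] by linarith
  qed
  with N(1) w_range show ?thesis by blast
qed

theorem theorem4p5:
  fixes M :: "'a measure" and meet :: "'a \<Rightarrow> 'a \<Rightarrow> 'a"
  assumes "borel_tree_semilattice M meet"
    and "prob_space M"
    and "atomless M"
  shows "\<exists>(A :: nat \<Rightarrow> nat set) (m :: nat \<Rightarrow> nat \<Rightarrow> nat \<Rightarrow> nat).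
           (\<forall>n. finite (A n) \<and> A n \<noteq> {} \<and> tree_semilattice (A n) (m n)) \<and>
           qf_converges (\<lambda>n. uniform_count_measure (A n)) m M meet"
proof -
  interpret tree_semilattice "space M" meet
    using assms(1) by (simp add: borel_tree_semilattice_def)
  \<comment> \<open>Stage \<open>n\<close> handles the formulas with codes up to \<open>n\<close>,
    with error below \<open>1 / Suc n\<close>.\<close>
  have "\<exists>(A :: nat set) m. finite A \<and> A \<noteq> {} \<and> tree_semilattice A m \<and>
      (\<forall>\<phi>\<in>from_nat ` {..n}. \<bar>stone_pairing \<phi> (uniform_count_measure A) m - stone_pairing \<phi> M meet\<bar> < 1 / Suc n)" for n
  proof -
    obtain N w where N: "N > 0" and w: "range w \<subseteq> space M"
      and approx: "\<forall>\<phi>\<in>from_nat ` {..n}. \<bar>stone_pairing \<phi> (uniform_count_measure (blowup meet w N)) (lex_meet meet) -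
        stone_pairing \<phi> M meet\<bar> < 1 / Suc n"
      using blowup_approximation[OF assms, of "from_nat ` {..n}" "1 / Suc n"] by auto
    let ?A = "blowup meet w N"
    have wN: "w ` {..<N} \<subseteq> space M" using w by auto
    have ne: "?A \<noteq> {}" using N by (auto simp: blowup_def pair_meets_def)
    obtain f :: "'a \<times> nat \<Rightarrow> nat" where f: "inj_on f ?A"
      using finite_imp_inj_to_nat_seg[OF finite_blowup] by metis
    let ?m = "\<lambda>x y. f (lex_meet meet (inv_into ?A f x) (inv_into ?A f y))"
    have "tree_semilattice (f ` ?A) ?m"
      by (rule tree_semilattice.tree_semilattice_transport[OF blowup_tree_semilattice[OF wN] f])
    moreover have "stone_pairing \<phi> (uniform_count_measure (f ` ?A)) ?m =
        stone_pairing \<phi> (uniform_count_measure ?A) (lex_meet meet)" for \<phi>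
      by (rule stone_pairing_transport[OF finite_blowup ne f blowup_closed[OF wN]])
    ultimately show ?thesis
      using ne approx by (intro exI[of _ "f ` ?A"] exI[of _ ?m]) simp
  qed
  then obtain A :: "nat \<Rightarrow> nat set" and m where
    A: "\<And>n. finite (A n) \<and> A n \<noteq> {} \<and> tree_semilattice (A n) (m n)" and
    approx: "\<And>n \<phi>. \<phi> \<in> from_nat ` {..n} \<Longrightarrow>
      \<bar>stone_pairing \<phi> (uniform_count_measure (A n)) (m n) - stone_pairing \<phi> M meet\<bar> < 1 / Suc n"
    by metis
  have "(\<lambda>n. stone_pairing \<phi> (uniform_count_measure (A n)) (m n)) \<longlonglongrightarrow> stone_pairing \<phi> M meet" for \<phi>
  proof (rule LIM_zero_cancel, rule Lim_null_comparison)
    show "\<forall>\<^sub>F n in sequentially. norm (stone_pairing \<phi> (uniform_count_measure (A n)) (m n) - stone_pairing \<phi> M meet) \<le> 1 / Suc n"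
      using eventually_ge_at_top[of "to_nat \<phi>"]
    proof eventually_elim
      case (elim n)
      \<comment> \<open>From stage \<open>to_nat \<phi>\<close> on, the formula is among those that
        are approximated.\<close>
      then have "\<phi> \<in> from_nat ` {..n}"
        by (intro image_eqI[of _ _ "to_nat \<phi>"]) auto
      from approx[OF this] show ?case by simp
    qed
    show "(\<lambda>n. 1 / real (Suc n)) \<longlonglongrightarrow> 0"
      by (rule LIMSEQ_Suc[OF lim_1_over_n])
  qed
  with A show ?thesis
    unfolding qf_converges_def by blast
qed

end
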